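(* For all integers $m,n\ge 2$, $\chi_{lat}(A(mK_n,K_1))=n$.
   Context: Graphs are finite and simple. For $m,n\ge 2$, $A(mK_n,K_1)$ is the one-point union (amalgamation) of $m$ copies of $K_n$: the graph obtained from $m$ disjoint copies of $K_n$ by identifying one vertex from each copy into a single common vertex. For a graph $G$ of order $p$ and size $q$, a local antimagic total labeling of $G$ is a bijection $f:V(G)\cup E(G)\to\{1,\ldots,p+q\}$ such that $w_f(u)\neq w_f(v)$ for every edge $uv$ of $G$, where $w_f(u)=f(u)+\sum_{ux\in E(G)}f(ux)$. $\chi_{lat}(G)$ is the minimum number of distinct values of $w_f$ over all local antimagic total labelings $f$ of $G$. *)

theory Defs
  imports Main "HOL-Library.Extended_Nat"
begin

text \<open>A graph is a pair of a vertex set and a set of edges, each edge an unordered pair of vertices.\<close>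

type_synonym 'a ugraph = "'a set \<times> 'a set set"

abbreviation verts :: "'a ugraph \<Rightarrow> 'a set" where
  "verts G \<equiv> fst G"

abbreviation edges :: "'a ugraph \<Rightarrow> 'a set set" where
  "edges G \<equiv> snd G"

definition finite_simple_graph :: "'a ugraph \<Rightarrow> bool" where
  "finite_simple_graph G \<longleftrightarrow>
     finite (verts G) \<and>
     (\<forall>e \<in> edges G. \<exists>u v. e = {u, v} \<and> u \<in> verts G \<and> v \<in> verts G \<and> u \<noteq> v)"

definition complete_graph :: "'a set \<Rightarrow> 'a ugraph" where
  "complete_graph S = (S, {{u, v} | u v. u \<in> S \<and> v \<in> S \<and> u \<noteq> v})"

definition disjoint_copies :: "nat \<Rightarrow> 'a ugraph \<Rightarrow> (nat \<times> 'a) ugraph" where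
  "disjoint_copies m G =
     ({..<m} \<times> verts G, {Pair i ` e | i e. i < m \<and> e \<in> edges G})"

text \<open>Identification of vertices: vertices with the same image under \<open>\<phi>\<close> are merged.\<close>

definition image_graph :: "('a \<Rightarrow> 'b) \<Rightarrow> 'a ugraph \<Rightarrow> 'b ugraph" where
  "image_graph \<phi> G = (\<phi> ` verts G, (\<lambda>e. \<phi> ` e) ` edges G)"

text \<open>The copies of \<open>c\<close> are merged into the single vertex \<open>None\<close>;
  any other vertex \<open>x\<close> of the \<open>i\<close>-th copy becomes \<open>Some (i, x)\<close>.\<close>

definition one_point_union :: "nat \<Rightarrow> 'a ugraph \<Rightarrow> 'a \<Rightarrow> (nat \<times> 'a) option ugraph" where
  "one_point_union m G c =
     image_graph (\<lambda>(i, x). if x = c then None else Some (i, x)) (disjoint_copies m G)"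

text \<open>The complete graph is vertex-transitive, so which vertex is merged does not matter.\<close>

definition amalgamation_complete :: "nat \<Rightarrow> nat \<Rightarrow> (nat \<times> nat) option ugraph" where
  "amalgamation_complete m n = one_point_union m (complete_graph {..<n}) 0"

text \<open>A total labeling is a function on the disjoint sum of vertices (\<open>Inl\<close>) and edges (\<open>Inr\<close>).\<close>

definition weight :: "'a ugraph \<Rightarrow> ('a + 'a set \<Rightarrow> nat) \<Rightarrow> 'a \<Rightarrow> nat" where
  "weight G f u = f (Inl u) + (\<Sum>x \<in> {x. {u, x} \<in> edges G}. f (Inr {u, x}))"

definition local_antimagic_total :: "'a ugraph \<Rightarrow> ('a + 'a set \<Rightarrow> nat) \<Rightarrow> bool" where
  "local_antimagic_total G f \<longleftrightarrow>
     bij_betw f (verts G <+> edges G) {1..card (verts G) + card (edges G)} \<and>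
     (\<forall>u v. {u, v} \<in> edges G \<longrightarrow> weight G f u \<noteq> weight G f v)"

text \<open>The value is \<open>\<infinity>\<close> when there is no local antimagic total labeling; otherwise the
  infimum is attained, since \<open>enat\<close> is well-ordered.\<close>

definition chi_lat :: "'a ugraph \<Rightarrow> enat" where
  "chi_lat G = (INF f \<in> {f. local_antimagic_total G f}. enat (card (weight G f ` verts G)))"

lemma finite_simple_graph_amalgamation_complete:
  "finite_simple_graph (amalgamation_complete m n)"
  unfolding finite_simple_graph_def
proof (intro conjI ballI)
  let ?\<phi> = "\<lambda>(i::nat, x::nat). if x = 0 then None else Some (i, x)"
  let ?G = "amalgamation_complete m n"
  have V: "verts ?G = ?\<phi> ` ({..<m} \<times> {..<n})"
    by (simp add: amalgamation_complete_def one_point_union_def image_graph_def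
        disjoint_copies_def complete_graph_def)
  then show "finite (verts ?G)" by simp
  fix e assume "e \<in> edges ?G"
  then obtain i a b where i: "i < m" and ab: "a < n" "b < n" "a \<noteq> b"
    and e: "e = {?\<phi> (i, a), ?\<phi> (i, b)}"
    by (auto simp: amalgamation_complete_def one_point_union_def image_graph_def
        disjoint_copies_def complete_graph_def)
  have "?\<phi> (i, a) \<in> verts ?G" "?\<phi> (i, b) \<in> verts ?G"
    unfolding V using i ab by blast+
  moreover have "?\<phi> (i, a) \<noteq> ?\<phi> (i, b)" using ab by auto
  ultimately show "\<exists>u v. e = {u, v} \<and> u \<in> verts ?G \<and> v \<in> verts ?G \<and> u \<noteq> v"
    using e by blast
qed

end

theory Submission
  imports Defs
begin

text \<open>
  Each copy of \<open>K\<^sub>n\<close> is a clique, so a local antimagic total labeling gives its \<open>n\<close> vertices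
  distinct weights (\<open>card_clique_le_card_weights\<close>). It remains to find one labeling in which
  non-central vertices that correspond to each other in different copies have equal weights.

  Number the vertices of a copy by \<open>0, \<dots>, n - 1\<close>, with \<open>0\<close> for the common vertex. The labels used
  in copy \<open>k\<close> form a symmetric matrix \<open>label m n k i j\<close>: the entry off the diagonal is the label of
  the edge \<open>ij\<close>, the entry \<open>(i, i)\<close> with \<open>i > 0\<close> is that of the vertex \<open>i\<close>, and the entry \<open>(0, 0)\<close>
  is outside the scheme, as the common vertex belongs to all copies. For \<open>i > 0\<close> the weight of the
  vertex \<open>i\<close> of copy \<open>k\<close> is the sum of row \<open>i\<close>. Let every entry be an affine function of \<open>k\<close>. Then
  the row sum is independent of \<open>k\<close> as soon as the slopes in each row \<open>i > 0\<close> add up to \<open>0\<close>.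

  A position of slope \<open>1\<close> or \<open>-1\<close> can use up a block of \<open>m\<close> consecutive labels, in increasing or
  decreasing order of the copies. If \<open>n\<close> is even, the slopes \<open>(-1)\<^bsup>i+j\<^esup>\<close> are symmetric and cancel in
  every row. If \<open>n\<close> is odd, a row has an odd number of entries, and slopes of absolute value \<open>1\<close>
  cannot cancel. Here the edges at the common vertex get slope \<open>2\<close>. Two positions of slope \<open>2\<close>
  together use up a block of \<open>2m\<close> consecutive labels, one taking every other label of it, and the
  number \<open>n - 1\<close> of these positions is even. The signs \<open>(-1)\<^bsup>i+j\<^esup>\<close> with \<open>1 \<le> j \<le> n - 1\<close> cancel, and
  changing the diagonal one from \<open>1\<close> to \<open>-1\<close> makes up for the slope \<open>2\<close> (\<open>slope_sum_eq_0\<close>).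

  The order of the blocks makes the weights distinct. Among the entries \<open>1 \<le> i \<le> j\<close> they follow
  the lexicographic order of \<open>(j, i)\<close>, and the edges at the common vertex come last. Then a later
  row exceeds an earlier one entry by entry (\<open>row_sum_strict_mono\<close>). The common vertex receives
  the largest label of all, and its edges in one copy alone outweigh the rest of any row, so that
  its weight is larger than all row sums.
\<close>

section \<open>Vertices and edges of the amalgamation\<close>

definition vtx :: "nat \<Rightarrow> nat \<Rightarrow> (nat \<times> nat) option" where
  "vtx k x = (if x = 0 then None else Some (k, x))"

lemma vtx_eq_iff: "vtx k x = vtx l y \<longleftrightarrow> x = y \<and> (x = 0 \<or> k = l)"
  by (auto simp: vtx_def)

lemma verts_amalgamation_complete:
  "verts (amalgamation_complete m n) = {vtx k x | k x. k < m \<and> x < n}"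
proof -
  have "(\<lambda>(k, x). if x = 0 then None else Some (k, x)) = (\<lambda>(k, x). vtx k x)"
    by (auto simp: vtx_def fun_eq_iff)
  then show ?thesis
    unfolding amalgamation_complete_def one_point_union_def
    by (auto simp: image_graph_def disjoint_copies_def complete_graph_def)
qed

lemma edges_amalgamation_complete:
  "edges (amalgamation_complete m n) =
     {{vtx k i, vtx k j} | k i j. k < m \<and> i < n \<and> j < n \<and> i \<noteq> j}" (is "?L = ?R")
proof -
  let ?\<phi> = "\<lambda>(k, x). vtx k x"
  have \<phi>: "(\<lambda>(k, x). if x = 0 then None else Some (k, x)) = ?\<phi>"
    by (auto simp: vtx_def fun_eq_iff)
  have L: "?L = (\<lambda>e. ?\<phi> ` e) ` {Pair k ` e | k e. k < m \<and>
      e \<in> {{u, v} | u v. u \<in> {..<n} \<and> v \<in> {..<n} \<and> u \<noteq> v}}"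
    unfolding amalgamation_complete_def one_point_union_def \<phi>
    by (simp add: image_graph_def disjoint_copies_def complete_graph_def)
  show ?thesis
  proof (intro subset_antisym subsetI)
    fix e assume "e \<in> ?L"
    then show "e \<in> ?R" unfolding L by fastforce
  next
    fix e assume "e \<in> ?R"
    then obtain k i j where h: "e = {vtx k i, vtx k j}" "k < m" "i < n" "j < n" "i \<noteq> j"
      by blast
    have "e = ?\<phi> ` (Pair k ` {i, j})" using h by simp
    then show "e \<in> ?L" unfolding L using h by blast
  qed
qed

lemma edgeE:
  assumes "{u, v} \<in> edges (amalgamation_complete m n)"
  obtains k i j where "k < m" "i < n" "j < n" "i \<noteq> j" "u = vtx k i" "v = vtx k j"
proof -
  obtain k i j where h: "k < m" "i < n" "j < n" "i \<noteq> j" "{u, v} = {vtx k i, vtx k j}"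
    using assms unfolding edges_amalgamation_complete by blast
  from h(5) consider "u = vtx k i" "v = vtx k j" | "u = vtx k j" "v = vtx k i"
    unfolding doubleton_eq_iff by blast
  then show ?thesis
  proof cases
    case 1
    then show ?thesis using that[of k i j] h by simp
  next
    case 2
    then show ?thesis using that[of k j i] h by simp
  qed
qed

lemma edgeI:
  "k < m \<Longrightarrow> i < n \<Longrightarrow> j < n \<Longrightarrow> i \<noteq> j \<Longrightarrow>
    {vtx k i, vtx k j} \<in> edges (amalgamation_complete m n)"
  unfolding edges_amalgamation_complete
  by (intro CollectI exI[of _ k] exI[of _ i] exI[of _ j] conjI refl)

lemma neighbours_noncentral:
  assumes "k < m" "0 < i" "i < n"
  shows "{x. {vtx k i, x} \<in> edges (amalgamation_complete m n)} = vtx k ` ({..<n} - {i})"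
proof (intro subset_antisym subsetI)
  fix x assume "x \<in> {x. {vtx k i, x} \<in> edges (amalgamation_complete m n)}"
  then obtain l a b where h: "a < n" "b < n" "a \<noteq> b" "vtx k i = vtx l a" "x = vtx l b"
    by (blast elim: edgeE)
  then have "a = i" "l = k" using assms by (simp_all add: vtx_eq_iff)
  then show "x \<in> vtx k ` ({..<n} - {i})" using h by blast
next
  fix x assume "x \<in> vtx k ` ({..<n} - {i})"
  then show "x \<in> {x. {vtx k i, x} \<in> edges (amalgamation_complete m n)}"
    using assms by (auto intro: edgeI)
qed

lemma neighbours_centre:
  "{x. {None, x} \<in> edges (amalgamation_complete m n)} =
     (\<lambda>(k, i). vtx k i) ` ({..<m} \<times> {1..<n})"
proof (intro subset_antisym subsetI)
  fix x assume "x \<in> {x. {None, x} \<in> edges (amalgamation_complete m n)}"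
  then obtain k a b where h: "k < m" "a < n" "b < n" "a \<noteq> b" "None = vtx k a" "x = vtx k b"
    by (blast elim: edgeE)
  then have "a = 0" by (simp add: vtx_def split: if_splits)
  then have "(k, b) \<in> {..<m} \<times> {1..<n}" using h by simp
  then show "x \<in> (\<lambda>(k, i). vtx k i) ` ({..<m} \<times> {1..<n})" using h by force
next
  fix x assume "x \<in> (\<lambda>(k, i). vtx k i) ` ({..<m} \<times> {1..<n})"
  then obtain k i where h: "k < m" "0 < i" "i < n" "x = vtx k i"
    by (auto simp: Suc_le_eq)
  then have "{vtx k 0, x} \<in> edges (amalgamation_complete m n)"
    by (auto intro: edgeI)
  then show "x \<in> {x. {None, x} \<in> edges (amalgamation_complete m n)}" by (simp add: vtx_def)
qed

section \<open>A symmetric matrix of labels for each copy\<close>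

text \<open>The number of positions \<open>(a, b)\<close> with \<open>1 \<le> a \<le> b\<close> that precede the unordered pair \<open>{i, j}\<close>
  when ordered by \<open>b\<close> first.\<close>
definition start :: "nat \<Rightarrow> nat \<Rightarrow> nat" where
  "start i j = (max i j choose 2) + (min i j - 1)"

definition ramp :: "nat \<Rightarrow> bool \<Rightarrow> nat \<Rightarrow> nat" where
  "ramp m up k = (if up then k else m - 1 - k)"

text \<open>The label, counted from \<open>0\<close> within the range reserved for the edges at the common vertex, of
  the edge to vertex \<open>j\<close> in copy \<open>k\<close>. For odd \<open>n\<close> the vertices \<open>2a + 1\<close> and \<open>2a + 2\<close> share a range of
  \<open>2m\<close> labels and take alternate ones.\<close>

definition central_label :: "nat \<Rightarrow> nat \<Rightarrow> nat \<Rightarrow> nat \<Rightarrow> nat" where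
  "central_label m n k j =
     (if even n then m * (j - 1) + ramp m (even j) k
      else 2 * m * ((j - 1) div 2) + 2 * k + (j - 1) mod 2)"

definition label :: "nat \<Rightarrow> nat \<Rightarrow> nat \<Rightarrow> nat \<Rightarrow> nat \<Rightarrow> nat" where
  "label m n k i j = 1 +
     (if min i j = 0 then m * (n choose 2) + central_label m n k (max i j)
      else m * start i j + ramp m (even (i + j) \<and> \<not> (odd n \<and> i = j)) k)"

text \<open>The amount by which the entry \<open>(i, j)\<close> in a row \<open>i > 0\<close> grows from one copy to the next. The
  sign pattern is corrected for odd \<open>n\<close> only: to \<open>2\<close> in column \<open>0\<close>, and from \<open>1\<close> to \<open>-1\<close> on the
  diagonal.\<close>

definition slope :: "nat \<Rightarrow> nat \<Rightarrow> nat \<Rightarrow> int" where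
  "slope n i j = (-1) ^ (i + j) +
     (if odd n then (if j = 0 then 2 - (-1) ^ i else 0) + (if j = i then -2 else 0) else 0)"

lemma label_noncentral:
  "0 < i \<Longrightarrow> 0 < j \<Longrightarrow> label m n k i j =
     Suc (m * start i j + ramp m (even (i + j) \<and> \<not> (odd n \<and> i = j)) k)"
  by (simp add: label_def min_def)

lemma label_commute: "label m n k i j = label m n k j i"
  by (cases "i = j") (auto simp: label_def start_def min.commute max.commute add.commute)

lemma ramp_less: "k < m \<Longrightarrow> ramp m up k < m"
  by (auto simp: ramp_def)

lemma ramp_inject: "k < m \<Longrightarrow> k' < m \<Longrightarrow> ramp m up k = ramp m up k' \<Longrightarrow> k = k'"
  by (auto simp: ramp_def split: if_splits)

lemma ramp_slope:
  "k < m \<Longrightarrow> int (ramp m up k) = int (ramp m up 0) + (if up then 1 else -1) * int k"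
  by (auto simp: ramp_def of_nat_diff)

lemma choose_two_Suc: "Suc j choose 2 = (j choose 2) + j"
  by (simp add: numeral_2_eq_2)

lemma start_less:
  assumes "0 < i" "i < n" "0 < j" "j < n"
  shows "start i j < n choose 2"
proof -
  have "start i j < Suc (max i j) choose 2"
    using assms by (auto simp: start_def choose_two_Suc min_def max_def)
  also have "\<dots> \<le> n choose 2" using assms by (intro binomial_right_mono) auto
  finally show ?thesis .
qed

text \<open>The order of the blocks is monotone in each index although the pair is unordered, because
  both the minimum and the maximum are. Comparison of rows needs exactly this.\<close>

lemma start_strict_mono:
  assumes "0 < i" "i \<le> i'" "0 < j" "j \<le> j'" "min i j \<noteq> min i' j' \<or> max i j \<noteq> max i' j'"
  shows "start i j < start i' j'"
proof (cases "max i j = max i' j'")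
  case True
  then show ?thesis using assms by (auto simp: start_def min_def max_def split: if_splits)
next
  case False
  then have "max i j < max i' j'" using assms by linarith
  then have "Suc (max i j) choose 2 \<le> max i' j' choose 2"
    by (intro binomial_right_mono) auto
  moreover have "min i j - 1 < max i j" using assms by auto
  ultimately show ?thesis by (simp add: start_def choose_two_Suc)
qed

lemma start_inject:
  assumes "0 < i" "i \<le> j" "0 < i'" "i' \<le> j'" "start i j = start i' j'"
  shows "i = i' \<and> j = j'"
proof -
  have lt: "start a b < start a' b'"
    if "0 < a" "a \<le> b" "0 < a'" "a' \<le> b'" "b < b'" for a b a' b'
  proof -
    \<comment> \<open>Compare with the last position of maximum \<open>b\<close> and the first one of maximum \<open>b'\<close>.\<close>
    have "start a b \<le> start b b" "start b b < start 1 b'" "start 1 b' \<le> start a' b'"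
      using that start_strict_mono[of a b b b] start_strict_mono[of 1 a' b' b']
        binomial_right_mono[of "Suc b" b' 2]
      by (force simp: start_def choose_two_Suc)+
    then show ?thesis by linarith
  qed
  then have "j = j'" using assms by (metis nat_neq_iff less_irrefl)
  then show ?thesis using assms by (simp add: start_def)
qed

lemma block_less:
  fixes m q r N :: nat
  assumes "q < N" "r < m"
  shows "m * q + r < m * N"
proof -
  have "m * q + r < m * Suc q" using assms by simp
  also have "\<dots> \<le> m * N" using assms by (intro mult_le_mono2) simp
  finally show ?thesis .
qed

lemma central_label_less:
  assumes "k < m" "0 < j" "j < n"
  shows "central_label m n k j < m * (n - 1)"
proof (cases "even n")
  case True
  then show ?thesis using assms
    by (auto simp: central_label_def intro!: block_less ramp_less)
next
  case False
  \<comment> \<open>Only because \<open>n - 1\<close> is even do the pairs of vertices fill their ranges exactly.\<close>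
  then obtain t where t: "n = 2 * t + 1" by (blast elim: oddE)
  have "(j - 1) div 2 < t" using assms t by linarith
  moreover have "2 * k + (j - 1) mod 2 < 2 * m" using assms by linarith
  ultimately have "2 * m * ((j - 1) div 2) + (2 * k + (j - 1) mod 2) < 2 * m * t"
    by (rule block_less)
  then show ?thesis using False t by (simp add: central_label_def ac_simps)
qed

lemma central_label_inject:
  assumes "k < m" "0 < j" "k' < m" "0 < j'"
    "central_label m n k j = central_label m n k' j'"
  shows "k = k' \<and> j = j'"
proof (cases "even n")
  case True
  define r where "r = ramp m (even j) k"
  define r' where "r' = ramp m (even j') k'"
  have r: "r < m" "r' < m" using assms by (simp_all add: r_def r'_def ramp_less)
  have "m * (j - 1) + r = m * (j' - 1) + r'"
    using assms True by (simp add: central_label_def r_def r'_def)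
  then have "(m * (j - 1) + r) div m = (m * (j' - 1) + r') div m"
    "(m * (j - 1) + r) mod m = (m * (j' - 1) + r') mod m" by simp_all
  then have "j - 1 = j' - 1" "r = r'" using r by simp_all
  then have "j = j'" using assms by simp
  moreover have "k = k'"
    using \<open>r = r'\<close> assms unfolding r_def r'_def \<open>j = j'\<close> by (blast intro: ramp_inject)
  ultimately show ?thesis by simp
next
  case False
  define r where "r = 2 * k + (j - 1) mod 2"
  define r' where "r' = 2 * k' + (j' - 1) mod 2"
  have r: "r < 2 * m" "r' < 2 * m" using assms unfolding r_def r'_def by linarith+
  have "2 * m * ((j - 1) div 2) + r = 2 * m * ((j' - 1) div 2) + r'"
    using assms False by (simp add: central_label_def r_def r'_def)
  then have "(2 * m * ((j - 1) div 2) + r) div (2 * m) = (2 * m * ((j' - 1) div 2) + r') div (2 * m)"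
    "(2 * m * ((j - 1) div 2) + r) mod (2 * m) = (2 * m * ((j' - 1) div 2) + r') mod (2 * m)"
    by simp_all
  then have *: "(j - 1) div 2 = (j' - 1) div 2" "r = r'" using r by simp_all
  have "r div 2 = r' div 2" "r mod 2 = r' mod 2" using *(2) by simp_all
  then have "k = k'" "(j - 1) mod 2 = (j' - 1) mod 2" unfolding r_def r'_def by simp_all
  with *(1) have "j - 1 = j' - 1" by (metis div_mult_mod_eq)
  then show ?thesis using \<open>k = k'\<close> assms by simp
qed

lemma central_label_strict_mono:
  assumes "k < m" "0 < j" "j < j'"
  shows "central_label m n k j < central_label m n k j'"
proof (cases "even n")
  case True
  have "m * (j - 1) + ramp m (even j) k < m * (j' - 1)"
    using assms by (intro block_less ramp_less) auto
  then show ?thesis using True by (auto simp: central_label_def)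
next
  case False
  show ?thesis
  proof (cases "(j - 1) div 2 = (j' - 1) div 2")
    case True
    moreover have "j - 1 < j' - 1" using assms by simp
    ultimately have "(j - 1) mod 2 < (j' - 1) mod 2"
      by (metis div_mult_mod_eq nat_add_left_cancel_less)
    then show ?thesis using False True by (simp add: central_label_def)
  next
    case neq: False
    have "(j - 1) div 2 \<le> (j' - 1) div 2" using assms by (intro div_le_mono) simp
    then have "(j - 1) div 2 < (j' - 1) div 2" using neq by simp
    moreover have "2 * k + (j - 1) mod 2 < 2 * m" using assms by linarith
    ultimately have "2 * m * ((j - 1) div 2) + (2 * k + (j - 1) mod 2) < 2 * m * ((j' - 1) div 2)"
      by (rule block_less)
    then show ?thesis using False by (simp add: central_label_def)
  qed
qed

lemma label_le_blocks:
  assumes "k < m" "0 < i" "i < n" "0 < j" "j < n"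
  shows "label m n k i j \<le> m * (n choose 2)"
  using block_less[OF start_less[OF assms(2-5)] ramp_less[OF assms(1)]] assms
  by (simp add: label_def Suc_le_eq)

lemma label_central:
  "label m n k 0 j = Suc (m * (n choose 2) + central_label m n k j)"
  by (simp add: label_def)

lemma label_range:
  assumes "k < m" "i < n" "0 < j" "j < n"
  shows "label m n k i j \<in> {1..m * ((n choose 2) + (n - 1))}"
proof (cases "i = 0")
  case True
  then show ?thesis
    using central_label_less[of k m j n] assms
    unfolding True label_central distrib_left atLeastAtMost_iff by linarith
next
  case False
  then have "label m n k i j \<le> m * (n choose 2)" using assms by (intro label_le_blocks) auto
  moreover have "1 \<le> label m n k i j" by (simp add: label_def)
  ultimately show ?thesis by (simp add: distrib_left)
qed

section \<open>Every label is used exactly once\<close>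

text \<open>One triple \<open>(k, j, i)\<close> with \<open>i \<le> j\<close> for each unordered position of each copy. The larger index
  comes second, so that the excluded position \<open>(0, 0)\<close> is the only one with \<open>j = 0\<close>.\<close>

definition cells :: "nat \<Rightarrow> nat \<Rightarrow> (nat \<times> nat \<times> nat) set" where
  "cells m n = {..<m} \<times> (SIGMA j:{1..<n}. {..j})"

lemma card_cells: "0 < n \<Longrightarrow> card (cells m n) = m * ((n choose 2) + (n - 1))"
proof -
  assume "0 < n"
  then have "(\<Sum>j\<in>{1..<n}. Suc j) = (n choose 2) + (n - 1)"
  proof (induction n rule: nat_induct_non_zero)
    case 1
    then show ?case by simp
  next
    case (Suc n)
    then show ?case by (simp add: choose_two_Suc)
  qed
  then show ?thesis by (simp add: cells_def card_cartesian_product)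
qed

text \<open>Counting reduces this to injectivity. The size of a label tells whether the position is
  central, and division with remainder recovers the block and the copy.\<close>

lemma label_bij_betw:
  assumes "0 < n"
  shows "bij_betw (\<lambda>(k, j, i). label m n k i j) (cells m n) {1..m * ((n choose 2) + (n - 1))}"
proof -
  let ?f = "\<lambda>(k, j, i). label m n k i j"
  have inj: "k = k' \<and> i = i' \<and> j = j'"
    if h: "k < m" "0 < j" "j < n" "i \<le> j" "k' < m" "0 < j'" "j' < n" "i' \<le> j'"
      and eq: "label m n k i j = label m n k' i' j'" for k i j k' i' j'
  proof -
    have small: "a = 0 \<longleftrightarrow> label m n l a b > m * (n choose 2)"
      if "l < m" "0 < b" "b < n" "a \<le> b" for l a b
      using label_le_blocks[of l m a n b] that by (force simp: label_central)
    have iff: "i = 0 \<longleftrightarrow> i' = 0" using small[of k j i] small[of k' j' i'] h eq by simp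
    show ?thesis
    proof (cases "i = 0")
      case True
      then show ?thesis using iff eq h central_label_inject[of k m j k' j' n]
        by (simp add: label_central)
    next
      case False
      define r where "r = ramp m (even (i + j) \<and> \<not> (odd n \<and> i = j)) k"
      define r' where "r' = ramp m (even (i' + j') \<and> \<not> (odd n \<and> i' = j')) k'"
      have r: "r < m" "r' < m" using h by (simp_all add: r_def r'_def ramp_less)
      have "m * start i j + r = m * start i' j' + r'"
        using eq False iff h by (simp add: label_def r_def r'_def)
      then have "(m * start i j + r) div m = (m * start i' j' + r') div m"
        "(m * start i j + r) mod m = (m * start i' j' + r') mod m" by simp_all
      then have "start i j = start i' j'" and rr: "r = r'" using r by simp_all
      then have ij: "i = i'" "j = j'" using start_inject[of i j i' j'] False iff h by simp_all
      have "k = k'" using rr h unfolding r_def r'_def ij by (blast intro: ramp_inject)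
      then show ?thesis using ij by simp
    qed
  qed
  have "inj_on ?f (cells m n)"
  proof (rule inj_onI)
    fix x y assume h: "x \<in> cells m n" "y \<in> cells m n" "?f x = ?f y"
    obtain k j i where x: "x = (k, j, i)" by (cases x)
    obtain k' j' i' where y: "y = (k', j', i')" by (cases y)
    show "x = y" using h inj[of k j i k' j' i'] unfolding x y by (simp add: cells_def)
  qed
  moreover have "?f ` cells m n \<subseteq> {1..m * ((n choose 2) + (n - 1))}"
  proof (rule image_subsetI)
    fix x assume h: "x \<in> cells m n"
    obtain k j i where x: "x = (k, j, i)" by (cases x)
    show "?f x \<in> {1..m * ((n choose 2) + (n - 1))}"
      using h label_range[of k m i n j] unfolding x by (simp add: cells_def)
  qed
  ultimately show ?thesis
    using card_cells[OF assms] by (simp add: bij_betw_def card_image card_subset_eq)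
qed

section \<open>Row sums are independent of the copy and distinct\<close>

definition row_sum :: "nat \<Rightarrow> nat \<Rightarrow> nat \<Rightarrow> nat \<Rightarrow> nat" where
  "row_sum m n k i = (\<Sum>j<n. label m n k i j)"

lemma label_slope:
  assumes "k < m" "0 < i"
  shows "int (label m n k i j) = int (label m n 0 i j) + slope n i j * int k"
proof (cases "j = 0")
  case True
  show ?thesis
  proof (cases "even n")
    case even: True
    have "slope n i j = (if even i then 1 else -1)" using even True by (simp add: slope_def)
    then show ?thesis
      using True even assms ramp_slope[of k m "even i"]
      by (simp add: label_def central_label_def)
  next
    case False
    then have "slope n i j = 2" using True assms by (simp add: slope_def)
    then show ?thesis using True False assms by (simp add: label_def central_label_def)
  qed
next
  case False
  define up where "up \<longleftrightarrow> even (i + j) \<and> \<not> (odd n \<and> i = j)"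
  have label: "label m n l i j = Suc (m * start i j + ramp m up l)" for l
    using False assms by (simp add: label_noncentral up_def)
  have "slope n i j = (if up then 1 else -1)"
    using False by (cases "i = j") (simp_all add: slope_def up_def minus_one_power_iff)
  then show ?thesis using ramp_slope[of k m up] assms by (simp add: label)
qed

lemma alternating_sum: "(\<Sum>j<n. (-1) ^ (i + j)) = (if even n then 0 else (-1 :: int) ^ i)"
  by (induction n) (auto simp: power_add)

lemma slope_sum_eq_0:
  assumes "0 < i" "i < n"
  shows "(\<Sum>j<n. slope n i j) = 0"
proof (cases "even n")
  case True
  then show ?thesis using alternating_sum[of i n] by (simp add: slope_def)
next
  case False
  have "(\<Sum>j<n. slope n i j) = (\<Sum>j<n. (-1) ^ (i + j)) +
      ((\<Sum>j<n. if j = 0 then 2 - (-1) ^ i else 0) + (\<Sum>j<n. if j = i then -2 else 0))"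
    using False by (simp only: slope_def sum.distrib if_True simp_thms)
  also have "\<dots> = (-1) ^ i + ((2 - (-1) ^ i) + (-2))"
    using False assms by (simp only: alternating_sum sum.delta) simp
  finally show ?thesis by simp
qed

lemma row_sum_independent_of_copy:
  assumes "k < m" "0 < i" "i < n"
  shows "row_sum m n k i = row_sum m n 0 i"
proof -
  have "int (row_sum m n k i) = (\<Sum>j<n. int (label m n 0 i j) + slope n i j * int k)"
    unfolding row_sum_def of_nat_sum using assms by (intro sum.cong refl label_slope)
  also have "\<dots> = int (row_sum m n 0 i) + (\<Sum>j<n. slope n i j) * int k"
    by (simp only: sum.distrib sum_distrib_right row_sum_def of_nat_sum)
  also have "\<dots> = int (row_sum m n 0 i)" using slope_sum_eq_0[OF assms(2,3)] by simp
  finally show ?thesis by simp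
qed

text \<open>In each column the entry of a later row lies in a later block. For odd \<open>n\<close>, entries of column
  \<open>0\<close> may share their range of \<open>2m\<close> labels, but in a fixed copy they are still in order.\<close>

lemma row_sum_strict_mono:
  assumes "0 < m" "0 < i" "i < i'" "i' < n"
  shows "row_sum m n 0 i < row_sum m n 0 i'"
  unfolding row_sum_def
proof (rule sum_strict_mono)
  show "finite {..<n}" by simp
  show "{..<n} \<noteq> {}" using assms by (simp add: lessThan_empty_iff)
next
  fix j assume "j \<in> {..<n}"
  show "label m n 0 i j < label m n 0 i' j"
  proof (cases "j = 0")
    case True
    moreover have "label m n 0 0 i < label m n 0 0 i'"
      using central_label_strict_mono[of 0 m i i' n] assms by (simp add: label_central)
    ultimately show ?thesis using label_commute by metis
  next
    case False
    have "start i j < start i' j"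
      using assms False by (intro start_strict_mono) (auto simp: min_def max_def)
    then have "m * start i j + ramp m (even (i + j) \<and> \<not> (odd n \<and> i = j)) 0 < m * start i' j"
      using assms by (intro block_less ramp_less)
    then show ?thesis using assms False by (simp add: label_noncentral)
  qed
qed

section \<open>The labeling of the amalgamation\<close>

definition place :: "nat \<times> nat \<times> nat \<Rightarrow> (nat \<times> nat) option + (nat \<times> nat) option set" where
  "place = (\<lambda>(k, j, i). if i = j then Inl (vtx k j) else Inr {vtx k i, vtx k j})"

lemma inj_on_place: "inj_on place (cells m n)"
proof (rule inj_onI)
  fix p q assume h: "p \<in> cells m n" "q \<in> cells m n" "place p = place q"
  obtain k j i where p: "p = (k, j, i)" by (cases p)
  obtain l b a where q: "q = (l, b, a)" by (cases q)
  note pq = p q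
  have j: "0 < j" "i \<le> j" "0 < b" "a \<le> b" using h pq by (auto simp: cells_def)
  show "p = q"
  proof (cases "i = j")
    case True
    then have "a = b" "vtx k j = vtx l b"
      using h(3) by (auto simp: pq place_def split: if_splits)
    then show ?thesis using True j by (simp add: pq vtx_eq_iff)
  next
    case False
    then have "a \<noteq> b" "{vtx k i, vtx k j} = {vtx l a, vtx l b}"
      using h(3) by (auto simp: pq place_def split: if_splits)
    then consider "vtx k i = vtx l a" "vtx k j = vtx l b" | "vtx k i = vtx l b" "vtx k j = vtx l a"
      unfolding doubleton_eq_iff by blast
    then show ?thesis
      using False j \<open>a \<noteq> b\<close> by cases (auto simp: pq vtx_eq_iff)
  qed
qed

lemma place_cells:
  assumes "0 < m" "0 < n"
  shows "verts (amalgamation_complete m n) <+> edges (amalgamation_complete m n) =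
    insert (Inl None) (place ` cells m n)" (is "?L = ?R")
proof (intro subset_antisym subsetI)
  fix x assume x: "x \<in> ?L"
  consider k i where "k < m" "i < n" "x = Inl (vtx k i)"
    | k i j where "k < m" "i < j" "j < n" "x = Inr {vtx k i, vtx k j}"
  proof (cases x)
    case (Inl v)
    then show ?thesis using x that(1) unfolding verts_amalgamation_complete by blast
  next
    case (Inr e)
    then obtain k i j where h: "k < m" "i < n" "j < n" "i \<noteq> j" "e = {vtx k i, vtx k j}"
      using x unfolding edges_amalgamation_complete by blast
    then show ?thesis
      using that(2)[of k i j] that(2)[of k j i] Inr by (cases "i < j") (auto simp: insert_commute)
  qed
  then show "x \<in> ?R"
  proof cases
    case 1
    then have "i = 0 \<or> (k, i, i) \<in> cells m n" by (auto simp: cells_def)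
    moreover have "x = place (k, i, i)" using 1 by (simp add: place_def)
    ultimately show ?thesis using 1 by (auto simp: vtx_def)
  next
    case 2
    then have "(k, j, i) \<in> cells m n" by (auto simp: cells_def)
    moreover have "x = place (k, j, i)" using 2 by (simp add: place_def)
    ultimately show ?thesis by blast
  qed
next
  fix x assume x: "x \<in> ?R"
  show "x \<in> ?L"
  proof (cases "x = Inl None")
    case True
    have "vtx 0 0 \<in> verts (amalgamation_complete m n)"
      unfolding verts_amalgamation_complete using assms by blast
    then show ?thesis using True by (auto simp: vtx_def)
  next
    case False
    then obtain k j i where h: "x = place (k, j, i)" "k < m" "0 < j" "j < n" "i \<le> j"
      using x by (auto simp: cells_def)
    show ?thesis
    proof (cases "i = j")
      case True
      moreover have "vtx k j \<in> verts (amalgamation_complete m n)"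
        unfolding verts_amalgamation_complete using h by blast
      ultimately show ?thesis using h by (simp add: place_def InlI)
    next
      case False
      then have "{vtx k i, vtx k j} \<in> edges (amalgamation_complete m n)"
        using h by (intro edgeI) auto
      then show ?thesis using h False by (simp add: place_def InrI)
    qed
  qed
qed

definition total_label ::
    "nat \<Rightarrow> nat \<Rightarrow> (nat \<times> nat) option + (nat \<times> nat) option set \<Rightarrow> nat" where
  "total_label m n x =
     (if x = Inl None then Suc (m * ((n choose 2) + (n - 1)))
      else (\<lambda>(k, j, i). label m n k i j) (inv_into (cells m n) place x))"

lemma centre_notin_place_cells: "Inl None \<notin> place ` cells m n"
  by (auto simp: place_def cells_def vtx_def split: if_splits)

lemma total_label_place:
  assumes "p \<in> cells m n"
  shows "total_label m n (place p) = (\<lambda>(k, j, i). label m n k i j) p"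
proof -
  have "place p \<noteq> Inl None" using centre_notin_place_cells[of m n] assms by force
  then show ?thesis using assms by (simp add: total_label_def inv_into_f_f[OF inj_on_place])
qed

lemma total_label_centre:
  "total_label m n (Inl None) = Suc (m * ((n choose 2) + (n - 1)))"
  by (simp add: total_label_def)

lemma total_label_vertex:
  assumes "k < m" "0 < i" "i < n"
  shows "total_label m n (Inl (vtx k i)) = label m n k i i"
  using total_label_place[of "(k, i, i)"] assms by (simp add: cells_def place_def)

lemma total_label_edge:
  assumes "k < m" "i < n" "j < n" "i \<noteq> j"
  shows "total_label m n (Inr {vtx k i, vtx k j}) = label m n k i j"
proof -
  have *: "total_label m n (Inr {vtx k a, vtx k b}) = label m n k a b" if "a < b" "b < n" for a b
    using total_label_place[of "(k, b, a)"] assms that by (simp add: cells_def place_def)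
  show ?thesis
    using *[of i j] *[of j i] assms by (metis insert_commute label_commute linorder_neqE_nat)
qed

lemma total_label_bij_betw:
  assumes "0 < m" "0 < n"
  defines "G \<equiv> amalgamation_complete m n"
  shows "bij_betw (total_label m n) (verts G <+> edges G) {1..card (verts G) + card (edges G)}"
proof -
  let ?M = "m * ((n choose 2) + (n - 1))"
  have dom: "verts G <+> edges G = insert (Inl None) (place ` cells m n)"
    using place_cells assms by simp
  have "finite (verts G <+> edges G)" unfolding dom by (simp add: cells_def)
  then have fin: "finite (verts G)" "finite (edges G)" by (simp_all add: finite_Plus_iff)
  have "bij_betw (total_label m n \<circ> place) (cells m n) {1..?M}"
    using label_bij_betw[OF assms(2)] bij_betw_cong[of "cells m n" "total_label m n \<circ> place"]
      total_label_place by simp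
  then have "bij_betw (total_label m n) (place ` cells m n) {1..?M}"
    using bij_betw_comp_iff[OF inj_on_imp_bij_betw[OF inj_on_place]] by blast
  then have "bij_betw (total_label m n) (insert (Inl None) (place ` cells m n))
      (insert (Suc ?M) {1..?M})"
    using centre_notin_place_cells[of m n]
      notIn_Un_bij_betw[of "Inl None" "place ` cells m n" "total_label m n" "{1..?M}"]
    by (simp add: total_label_centre)
  moreover have "insert (Suc ?M) {1..?M} = {1..Suc ?M}" by auto
  ultimately have bij: "bij_betw (total_label m n) (verts G <+> edges G) {1..Suc ?M}"
    unfolding dom by simp
  \<comment> \<open>The order plus the size of the graph need not be computed: it is the size of the domain
    of this bijection.\<close>
  then have "card (verts G) + card (edges G) = Suc ?M"
    using bij_betw_same_card[OF bij] fin by (simp add: card_Plus)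
  then show ?thesis using bij by simp
qed

lemma total_label_antimagic:
  assumes m: "0 < m" and n: "2 \<le> n"
  defines "G \<equiv> amalgamation_complete m n"
  defines "f \<equiv> total_label m n"
  shows "local_antimagic_total G f" "card (weight G f ` verts G) \<le> n"
proof -
  have n0: "0 < n" using n by simp
  \<comment> \<open>The vertex label is the diagonal entry that the edges leave out of the row.\<close>
  have w_row: "weight G f (vtx k i) = row_sum m n 0 i" if "k < m" "0 < i" "i < n" for k i
  proof -
    have "inj_on (vtx k) ({..<n} - {i})" by (auto simp: inj_on_def vtx_eq_iff)
    then have "weight G f (vtx k i) = label m n k i i + (\<Sum>j\<in>{..<n} - {i}. label m n k i j)"
      unfolding weight_def G_def neighbours_noncentral[OF that]
      using that by (simp add: sum.reindex f_def total_label_vertex total_label_edge)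
    also have "\<dots> = row_sum m n k i"
      using that by (simp add: row_sum_def sum.remove[of "{..<n}" i])
    also have "\<dots> = row_sum m n 0 i" using that by (rule row_sum_independent_of_copy)
    finally show ?thesis .
  qed
  \<comment> \<open>The label of the centre exceeds the entry in column \<open>0\<close>; the other \<open>n - 1\<close> entries of the row
    are below the labels of the \<open>n - 1\<close> central edges of copy \<open>0\<close>.\<close>
  have w_centre: "row_sum m n 0 i < weight G f None" if i: "0 < i" "i < n" for i
  proof -
    have split: "{..<n} = insert 0 {1..<n}" using n by auto
    have "row_sum m n 0 i = label m n 0 i 0 + (\<Sum>j\<in>{1..<n}. label m n 0 i j)"
      unfolding row_sum_def split by simp
    also have "\<dots> < f (Inl None) + (\<Sum>j\<in>{1..<n}. label m n 0 0 j)"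
    proof (rule add_less_le_mono)
      show "label m n 0 i 0 < f (Inl None)"
        unfolding label_commute[of m n 0 i 0] f_def total_label_centre
        using label_range[of 0 m 0 n i] i m by simp
      show "(\<Sum>j\<in>{1..<n}. label m n 0 i j) \<le> (\<Sum>j\<in>{1..<n}. label m n 0 0 j)"
      proof (rule sum_mono)
        fix j assume "j \<in> {1..<n}"
        then show "label m n 0 i j \<le> label m n 0 0 j"
          using label_le_blocks[of 0 m i n j] i m by (simp add: label_central)
      qed
    qed
    also have "(\<Sum>j\<in>{1..<n}. label m n 0 0 j) = (\<Sum>j\<in>{1..<n}. f (Inr {None, vtx 0 j}))"
    proof (rule sum.cong)
      fix j assume "j \<in> {1..<n}"
      then show "label m n 0 0 j = f (Inr {None, vtx 0 j})"
        using total_label_edge[of 0 m 0 n j] m by (simp add: vtx_def f_def)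
    qed simp
    also have "\<dots> = (\<Sum>x\<in>vtx 0 ` {1..<n}. f (Inr {None, x}))"
      by (subst sum.reindex) (auto simp: inj_on_def vtx_eq_iff)
    also have "\<dots> \<le> (\<Sum>x\<in>(\<lambda>(k, i). vtx k i) ` ({..<m} \<times> {1..<n}). f (Inr {None, x}))"
      using m by (intro sum_mono2) auto
    finally show ?thesis unfolding weight_def G_def neighbours_centre by simp
  qed
  show "local_antimagic_total G f"
    unfolding local_antimagic_total_def
  proof (intro conjI allI impI)
    show "bij_betw f (verts G <+> edges G) {1..card (verts G) + card (edges G)}"
      unfolding G_def f_def using m n0 by (rule total_label_bij_betw)
  next
    fix u v assume "{u, v} \<in> edges G"
    then obtain k i j where h: "k < m" "i < n" "j < n" "i \<noteq> j" "u = vtx k i" "v = vtx k j"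
      unfolding G_def by (rule edgeE)
    have "weight G f (vtx k a) \<noteq> weight G f (vtx k b)" if "a < b" "b < n" for a b
    proof (cases "a = 0")
      case True
      then show ?thesis using w_centre[of b] w_row[of k b] that h by (simp add: vtx_def)
    next
      case False
      then show ?thesis
        using row_sum_strict_mono[of m a b n] w_row[of k a] w_row[of k b] that h m by simp
    qed
    then show "weight G f u \<noteq> weight G f v" using h by (metis linorder_neqE_nat)
  qed
  show "card (weight G f ` verts G) \<le> n"
  proof -
    let ?W = "insert (weight G f None) (row_sum m n 0 ` {1..<n})"
    have "weight G f ` verts G \<subseteq> ?W"
    proof (rule image_subsetI)
      fix u assume "u \<in> verts G"
      then obtain k i where "k < m" "i < n" "u = vtx k i"
        unfolding G_def verts_amalgamation_complete by blast
      then show "weight G f u \<in> ?W"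
        using w_row[of k i] by (cases "i = 0") (auto simp: vtx_def)
    qed
    then have "card (weight G f ` verts G) \<le> card ?W" by (intro card_mono) auto
    also have "\<dots> \<le> Suc (card (row_sum m n 0 ` {1..<n}))" by (simp add: card_insert_if)
    also have "\<dots> \<le> n" using card_image_le[of "{1..<n}" "row_sum m n 0"] n by simp
    finally show ?thesis .
  qed
qed

section \<open>Cliques bound the number of weights from below\<close>

lemma card_clique_le_card_weights:
  assumes "finite (verts G)" "S \<subseteq> verts G"
    and clique: "\<And>u v. u \<in> S \<Longrightarrow> v \<in> S \<Longrightarrow> u \<noteq> v \<Longrightarrow> {u, v} \<in> edges G"
    and "local_antimagic_total G f"
  shows "card S \<le> card (weight G f ` verts G)"
proof -
  have "inj_on (weight G f) S"
    using clique assms(4) unfolding local_antimagic_total_def inj_on_def by blast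
  then have "card S = card (weight G f ` S)" by (simp add: card_image)
  also have "\<dots> \<le> card (weight G f ` verts G)" using assms by (intro card_mono) auto
  finally show ?thesis .
qed

theorem theorem3p5:
  fixes m n :: nat
  assumes "m \<ge> 2" and "n \<ge> 2"
  shows "chi_lat (amalgamation_complete m n) = enat n"
proof (rule antisym)
  let ?G = "amalgamation_complete m n"
  have m: "0 < m" using assms by simp
  show "chi_lat ?G \<le> enat n"
    unfolding chi_lat_def using total_label_antimagic[OF m assms(2)]
    by (intro INF_lower2[of "total_label m n"]) auto
  show "enat n \<le> chi_lat ?G"
    unfolding chi_lat_def
  proof (rule INF_greatest)
    fix f assume "f \<in> {f. local_antimagic_total ?G f}"
    then have f: "local_antimagic_total ?G f" by simp
    let ?S = "vtx 0 ` {..<n}"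
    have "inj_on (vtx 0) {..<n}" by (auto simp: inj_on_def vtx_eq_iff)
    then have "n = card ?S" by (simp add: card_image)
    also have "\<dots> \<le> card (weight ?G f ` verts ?G)"
    proof (rule card_clique_le_card_weights[OF _ _ _ f])
      show "finite (verts ?G)"
        using finite_simple_graph_amalgamation_complete[of m n]
        by (simp add: finite_simple_graph_def)
      show "?S \<subseteq> verts ?G" unfolding verts_amalgamation_complete using m by blast
      show "{u, v} \<in> edges ?G" if "u \<in> ?S" "v \<in> ?S" "u \<noteq> v" for u v
        using that m by (auto intro!: edgeI)
    qed
    finally show "enat n \<le> enat (card (weight ?G f ` verts ?G))" by simp
  qed
qed

end
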